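(* Let $k,m,\alpha$ be integers such that $k\ge 3$, $m\ge 4$ and $\alpha\ge 0$, and let $v_1,\dots,v_m\in V$. Then $$\operatorname{rk}\big(S_{k,\alpha}(v_1,\dots,v_m)\big)\le \sum_{j=0}^{k-4}\binom{m+j-4}{j}\left\lceil\frac{(k-j+1)^2}{4}\right\rceil+2\binom{m+k-6}{k-2}+4\binom{m+k-7}{k-3},$$ where the sum over $j$ is empty (equal to $0$) when $k=3$.
   Context: Let $\mathbb{K}\in\{\mathbb{R},\mathbb{C}\}$ and let $V$ be a finite-dimensional $\mathbb{K}$-vector space. A tensor in $V^{\otimes k}$ is elementary if it is of the form $w_1\otimes\cdots\otimes w_k$ with $w_i\in V$; the rank $\operatorname{rk}(T)$ of a tensor $T\in V^{\otimes k}$ is the minimum number $r$ such that $T$ is a sum of $r$ elementary tensors (over $\mathbb{K}$). For integers $k\ge 2$, $\alpha\ge 0$ and vectors $v_1,\dots,v_m\in V$ define $$S_{k,\alpha}(v_1,\dots,v_m)=\sum_{a_1+\cdots+a_m=k}\frac{v_1^{\otimes a_1}\otimes v_2^{\otimes a_2}\otimes\cdots\otimes v_m^{\otimes a_m}}{(a_1+\alpha)!\,a_2!\cdots a_m!}\in V^{\otimes k},$$ the sum being over all tuples of non-negative integers $(a_1,\dots,a_m)$ with sum $k$. (For $\alpha=0$ this is the $k$-th signature tensor of the piecewise linear path whose consecutive segments are $v_1,\dots,v_m$.) *)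

theory Defs
  imports Complex_Main
begin

text \<open>
  Let \<open>V\<close> be a finite-dimensional vector space over \<open>K\<close>, given by a scalar multiplication
  \<open>scale\<close> on the type \<open>'v\<close>. The tensor power of order \<open>k\<close> is identified with the space of
  \<open>k\<close>-linear forms on the dual space: the tensor of \<open>w\<^sub>1, \<dots>, w\<^sub>k\<close> is the form sending
  \<open>(f\<^sub>1, \<dots>, f\<^sub>k)\<close> to \<open>f\<^sub>1 w\<^sub>1 * \<dots> * f\<^sub>k w\<^sub>k\<close>. Tuples are lists. As HOL functions are total,
  forms are extended by \<open>0\<close> to lists of the wrong length and to lists containing
  a non-linear function.
\<close>

type_synonym ('k, 'v) tensor = "('v \<Rightarrow> 'k) list \<Rightarrow> 'k"

definition elementary_tensor ::
    "('k::field \<Rightarrow> 'v::ab_group_add \<Rightarrow> 'v) \<Rightarrow> 'v list \<Rightarrow> ('k, 'v) tensor" where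
  "elementary_tensor scale ws = (\<lambda>fs.
     if length fs = length ws \<and> (\<forall>f\<in>set fs. Vector_Spaces.linear scale (*) f)
     then \<Prod>i<length ws. (fs ! i) (ws ! i) else 0)"

definition tensor_rank ::
    "('k::field \<Rightarrow> 'v::ab_group_add \<Rightarrow> 'v) \<Rightarrow> nat \<Rightarrow> ('k, 'v) tensor \<Rightarrow> nat" where
  "tensor_rank scale k T = (LEAST r. \<exists>W. length W = r \<and> (\<forall>ws\<in>set W. length ws = k) \<and>
     T = (\<lambda>fs. \<Sum>ws\<leftarrow>W. elementary_tensor scale ws fs))"

text \<open>
  Entries \<open>a ! 0\<close> and \<open>vs ! 0\<close> are the \<open>a\<^sub>1\<close> and \<open>v\<^sub>1\<close> of the usual notation; the list
  \<open>concat (map2 replicate a vs)\<close> consists of \<open>a\<^sub>1\<close> copies of \<open>v\<^sub>1\<close>, then \<open>a\<^sub>2\<close> copies of \<open>v\<^sub>2\<close>, etc.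
\<close>

definition S_tensor ::
    "('k::field_char_0 \<Rightarrow> 'v::ab_group_add \<Rightarrow> 'v) \<Rightarrow> nat \<Rightarrow> nat \<Rightarrow> 'v list \<Rightarrow> ('k, 'v) tensor" where
  "S_tensor scale k \<alpha> vs = (\<lambda>fs.
     \<Sum>a | length a = length vs \<and> sum_list a = k.
       elementary_tensor scale (concat (map2 replicate a vs)) fs /
         (fact (a ! 0 + \<alpha>) * (\<Prod>i=1..<length vs. fact (a ! i))))"

lemma finite_compositions: "finite {a :: nat list. length a = m \<and> sum_list a = k}"
  by (rule finite_subset[OF _ finite_lists_length_eq[of "{..k}" m]])
     (auto dest: member_le_sum_list)

text \<open>
  The two defining properties of the tensor power: the map \<open>elementary_tensor scale\<close> is linear
  in every argument, and the tensors of basis vectors are linearly independent.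
\<close>

lemma (in vector_space) elementary_tensor_multilinear:
  assumes "i < length ws"
  shows "elementary_tensor scale (ws[i := x + y]) fs =
           elementary_tensor scale (ws[i := x]) fs + elementary_tensor scale (ws[i := y]) fs"
    and "elementary_tensor scale (ws[i := scale c x]) fs =
           c * elementary_tensor scale (ws[i := x]) fs"
proof -
  have split: "elementary_tensor scale (ws[i := z]) fs =
      (if length fs = length ws \<and> (\<forall>f\<in>set fs. Vector_Spaces.linear scale (*) f)
       then (fs ! i) z * (\<Prod>j\<in>{..<length ws} - {i}. (fs ! j) (ws ! j)) else 0)" for z
    using assms by (auto simp: elementary_tensor_def prod.remove[of _ i] intro!: prod.cong)
  have lin: "Vector_Spaces.linear scale (*) (fs ! i)"
    if "length fs = length ws" "\<forall>f\<in>set fs. Vector_Spaces.linear scale (*) f"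
    using that assms by auto
  show "elementary_tensor scale (ws[i := x + y]) fs =
           elementary_tensor scale (ws[i := x]) fs + elementary_tensor scale (ws[i := y]) fs"
    using lin by (simp add: split Vector_Spaces.linear_iff distrib_right)
  show "elementary_tensor scale (ws[i := scale c x]) fs =
           c * elementary_tensor scale (ws[i := x]) fs"
    using lin by (simp add: split Vector_Spaces.linear_iff)
qed

lemma (in finite_dimensional_vector_space) elementary_tensor_basis_independent:
  assumes zero: "\<And>fs. (\<Sum>bs | length bs = k \<and> set bs \<subseteq> Basis.
      c bs * elementary_tensor scale bs fs) = 0"
    and cs: "length cs = k" "set cs \<subseteq> Basis"
  shows "c cs = 0"
proof -
  let ?fs = "map (\<lambda>b x. representation Basis x b) cs"
  let ?B = "{bs. length bs = k \<and> set bs \<subseteq> Basis}"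
  have lin: "Vector_Spaces.linear scale (*) (\<lambda>x. representation Basis x b)" for b
  proof -
    interpret K: vector_space "(*) :: 'a \<Rightarrow> 'a \<Rightarrow> 'a"
      by unfold_locales (auto simp: algebra_simps)
    show ?thesis
      by (simp add: Vector_Spaces.linear_iff representation_add representation_scale
          independent_Basis span_Basis vector_space_axioms K.vector_space_axioms)
  qed
  have eval: "elementary_tensor scale bs ?fs = (if bs = cs then 1 else 0)" if "bs \<in> ?B" for bs
  proof -
    have nth: "bs ! i \<in> Basis" if "i < k" for i
      using that \<open>bs \<in> ?B\<close> nth_mem by blast
    have "elementary_tensor scale bs ?fs = (\<Prod>i<k. if bs ! i = cs ! i then 1 else 0)"
      using that cs lin nth
      by (auto simp: elementary_tensor_def representation_basis independent_Basis intro!: prod.cong)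
    also have "\<dots> = (if bs = cs then 1 else 0)"
      using that cs by (auto simp: list_eq_iff_nth_eq intro!: prod_zero)
    finally show ?thesis .
  qed
  have fin: "finite ?B"
    using finite_lists_length_eq[OF finite_Basis, of k] by (simp add: conj_commute)
  have "0 = (\<Sum>bs\<in>?B. c bs * elementary_tensor scale bs ?fs)"
    using zero by simp
  also have "\<dots> = (\<Sum>bs\<in>?B. if bs = cs then c bs else 0)"
    by (intro sum.cong) (auto simp: eval)
  also have "\<dots> = c cs"
    using fin cs by (simp add: sum.delta)
  finally show ?thesis by simp
qed

end

theory Submission
  imports Defs
begin

text \<open>
  Splitting the sum defining \<open>S\<^sub>k\<^sub>,\<^sub>\<alpha>(v\<^sub>1, \<dots>, v\<^sub>m)\<close> according to whether the exponent of \<open>v\<^sub>1\<close>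
  vanishes gives
  \[ S_{k,\alpha}(v_1,\dots,v_m) = v_1 \otimes S_{k-1,\alpha+1}(v_1,\dots,v_m)
       + \frac{1}{\alpha!} S_{k,0}(v_2,\dots,v_m), \]
  which is why the shift \<open>\<alpha>\<close> is worth carrying along: the family is closed under peeling off
  the first factor (\<open>S_Suc\<close>). Hence a bound \<open>B(k,m)\<close> valid for every \<open>\<alpha>\<close> may be taken to satisfy
  \<open>B(k,m) = B(k-1,m) + B(k,m-1)\<close>; the bound of the theorem is the solution of this Pascal
  recurrence (\<open>rank_bound_Suc\<close>) for two boundary cases, in which grouping terms is more
  efficient than peeling.

  For \<open>m = 3\<close>, the terms with exponent \<open>0\<close> or \<open>1\<close> at \<open>v\<^sub>1\<close> can be collected into \<open>k\<close> elementary
  tensors \<open>x\<^sub>b \<otimes> v\<^sub>2\<^sup>b \<otimes> v\<^sub>3\<^sup>k\<^sup>-\<^sup>1\<^sup>-\<^sup>b\<close>. The others form \<open>v\<^sub>1 \<otimes> v\<^sub>1 \<otimes> S\<^sub>k\<^sub>-\<^sub>2\<^sub>,\<^sub>\<alpha>\<^sub>+\<^sub>2\<close>.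
  Iterating down to a remaining factor of order \<open>0\<close> or \<open>1\<close>, which costs one elementary tensor,
  the total \<open>k + (k-2) + (k-4) + \<dots> + 1\<close> is \<open>\<lceil>(k+1)\<^sup>2/4\<rceil>\<close> (\<open>rank_S_three_vectors\<close>).

  For \<open>k = 3\<close>, the order-one tensors \<open>S\<^sub>1\<^sub>,\<^sub>\<beta>\<close> are elementary, so that peeling off one vector
  produces only two new elementary tensors, while the terms with exponent one at that vector
  are absorbed by the remaining problem. This gives \<open>2m - 2\<close> (\<open>rank_S_order_three\<close>).

  The argument uses only that the factorials are invertible, so it is carried out over an
  arbitrary field of characteristic zero.
\<close>

section \<open>Sums of elementary tensors\<close>

locale char_0_vector_space = vector_space scale
  for scale :: "'k::field_char_0 \<Rightarrow> 'v::ab_group_add \<Rightarrow> 'v" (infixr "*s" 75)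
begin

abbreviation E :: "'v list \<Rightarrow> ('k, 'v) tensor" where
  "E \<equiv> elementary_tensor scale"

abbreviation S :: "nat \<Rightarrow> nat \<Rightarrow> 'v list \<Rightarrow> ('k, 'v) tensor" where
  "S \<equiv> S_tensor scale"

definition rank_at_most :: "nat \<Rightarrow> nat \<Rightarrow> ('k, 'v) tensor \<Rightarrow> bool" where
  "rank_at_most k r T \<longleftrightarrow> (\<exists>W. length W \<le> r \<and> (\<forall>ws\<in>set W. length ws = k) \<and>
     T = (\<lambda>fs. \<Sum>ws\<leftarrow>W. E ws fs))"

text \<open>
  The tensor \<open>v \<otimes> T\<close> as a form. The linearity test on \<open>f\<close> keeps the convention that forms vanish on
  lists containing a non-linear function; it also makes the form linear in \<open>v\<close>.
\<close>

definition tensor_Cons :: "'v \<Rightarrow> ('k, 'v) tensor \<Rightarrow> ('k, 'v) tensor" where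
  "tensor_Cons v T = (\<lambda>fs. case fs of [] \<Rightarrow> 0
     | f # gs \<Rightarrow> if Vector_Spaces.linear scale (*) f then f v * T gs else 0)"

lemma tensor_rank_le:
  assumes "rank_at_most k r T"
  shows "tensor_rank scale k T \<le> r"
proof -
  obtain W where W: "length W \<le> r" "\<forall>ws\<in>set W. length ws = k"
      "T = (\<lambda>fs. \<Sum>ws\<leftarrow>W. E ws fs)"
    using assms unfolding rank_at_most_def by blast
  have "tensor_rank scale k T \<le> length W"
    unfolding tensor_rank_def using W by (intro Least_le) blast
  with W show ?thesis by simp
qed

lemma rank_at_most_zero: "rank_at_most k 0 (\<lambda>fs. 0)"
  unfolding rank_at_most_def by (rule exI[of _ "[]"]) auto

lemma rank_at_most_elementary: "length ws = k \<Longrightarrow> rank_at_most k 1 (E ws)"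
  unfolding rank_at_most_def by (rule exI[of _ "[ws]"]) auto

lemma rank_at_most_add:
  assumes "rank_at_most k r T" "rank_at_most k s U"
  shows "rank_at_most k (r + s) (\<lambda>fs. T fs + U fs)"
proof -
  obtain W where W: "length W \<le> r" "\<forall>ws\<in>set W. length ws = k"
      "T = (\<lambda>fs. \<Sum>ws\<leftarrow>W. E ws fs)"
    using assms(1) unfolding rank_at_most_def by blast
  obtain X where X: "length X \<le> s" "\<forall>ws\<in>set X. length ws = k"
      "U = (\<lambda>fs. \<Sum>ws\<leftarrow>X. E ws fs)"
    using assms(2) unfolding rank_at_most_def by blast
  show ?thesis
    unfolding rank_at_most_def using W X by (intro exI[of _ "W @ X"]) auto
qed

lemma rank_at_most_sum:
  assumes "\<And>b. b < n \<Longrightarrow> length (ws b) = k"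
  shows "rank_at_most k n (\<lambda>fs. \<Sum>b<n. E (ws b) fs)"
  using assms
proof (induction n)
  case 0
  show ?case using rank_at_most_zero by simp
next
  case (Suc n)
  show ?case
    using rank_at_most_add[OF Suc.IH rank_at_most_elementary[of "ws n"]] Suc.prems by simp
qed

lemma elementary_tensor_Cons: "E (v # ws) = tensor_Cons v (E ws)"
proof
  fix fs :: "('v \<Rightarrow> 'k) list"
  show "E (v # ws) fs = tensor_Cons v (E ws) fs"
    by (cases fs) (auto simp: elementary_tensor_def tensor_Cons_def prod.lessThan_Suc_shift
        simp del: prod.lessThan_Suc)
qed

lemma tensor_Cons_add:
  "tensor_Cons v (\<lambda>gs. T gs + U gs) fs = tensor_Cons v T fs + tensor_Cons v U fs"
  by (auto simp: tensor_Cons_def distrib_left split: list.split)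

lemma tensor_Cons_divide: "tensor_Cons v (\<lambda>gs. T gs / c) fs = tensor_Cons v T fs / c"
  by (auto simp: tensor_Cons_def split: list.split)

lemma tensor_Cons_sum:
  "tensor_Cons v (\<lambda>gs. \<Sum>a\<in>A. T a gs) fs = (\<Sum>a\<in>A. tensor_Cons v (T a) fs)"
  by (auto simp: tensor_Cons_def sum_distrib_left split: list.split)

lemma tensor_Cons_add_vector:
  "tensor_Cons (x + y) T fs = tensor_Cons x T fs + tensor_Cons y T fs"
  by (auto simp: tensor_Cons_def Vector_Spaces.linear_iff distrib_right split: list.split)

lemma tensor_Cons_scale_vector: "tensor_Cons (c *s x) T fs = c * tensor_Cons x T fs"
  by (auto simp: tensor_Cons_def Vector_Spaces.linear_iff split: list.split)

lemma rank_at_most_tensor_Cons: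
  assumes "rank_at_most k r T"
  shows "rank_at_most (Suc k) r (tensor_Cons v T)"
proof -
  obtain W where W: "length W \<le> r" "\<forall>ws\<in>set W. length ws = k"
      "T = (\<lambda>fs. \<Sum>ws\<leftarrow>W. E ws fs)"
    using assms unfolding rank_at_most_def by blast
  have "tensor_Cons v T fs = (\<Sum>ws\<leftarrow>map ((#) v) W. E ws fs)" for fs
    unfolding W(3) by (auto simp: tensor_Cons_def elementary_tensor_Cons comp_def
        sum_list_const_mult split: list.split)
  then show ?thesis
    unfolding rank_at_most_def using W by (intro exI[of _ "map ((#) v) W"]) auto
qed

text \<open>
  A scalar is absorbed by the first factor. Tensors of order \<open>0\<close> have no factor to absorb it:
  there the only elementary tensor is \<open>1\<close>.
\<close>

lemma rank_at_most_mult: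
  assumes "rank_at_most (Suc k) r T"
  shows "rank_at_most (Suc k) r (\<lambda>fs. c * T fs)"
proof -
  obtain W where W: "length W \<le> r" "\<forall>ws\<in>set W. length ws = Suc k"
      "T = (\<lambda>fs. \<Sum>ws\<leftarrow>W. E ws fs)"
    using assms unfolding rank_at_most_def by blast
  let ?g = "\<lambda>ws. (c *s hd ws) # tl ws"
  have g: "E (?g ws) fs = c * E ws fs" if "ws \<in> set W" for ws fs
  proof -
    have "ws \<noteq> []"
      using W(2) that by force
    then have "E ws = E (hd ws # tl ws)"
      by simp
    then show ?thesis
      by (simp only: elementary_tensor_Cons tensor_Cons_scale_vector)
  qed
  have "c * T fs = (\<Sum>ws\<leftarrow>map ?g W. E ws fs)" for fs
    unfolding W(3) by (simp add: comp_def sum_list_const_mult[symmetric] g cong: map_cong)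
  then show ?thesis
    unfolding rank_at_most_def using W by (intro exI[of _ "map ?g W"]) auto
qed

lemma rank_at_most_divide:
  assumes "rank_at_most (Suc k) r T"
  shows "rank_at_most (Suc k) r (\<lambda>fs. T fs / c)"
  using rank_at_most_mult[OF assms, of "inverse c"] by (simp add: field_simps)

section \<open>Peeling off the first factor\<close>

lemma compositions_length_one: "{a::nat list. length a = Suc 0 \<and> sum_list a = k} = {[k]}"
  by (auto simp: length_Suc_conv)

lemma S_single: "S k \<alpha> [v] = (\<lambda>fs. E (replicate k v) fs / fact (k + \<alpha>))"
  by (simp add: S_tensor_def compositions_length_one)

lemma S_coefficient_Cons:
  fixes a :: "nat list"
  assumes "length a = Suc m"
  shows "(\<Prod>i=1..<Suc (Suc m). fact ((x # a) ! i)) =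
           (fact (a ! 0) * (\<Prod>i=1..<Suc m. fact (a ! i)) :: 'k)"
proof -
  have "(\<Prod>i=1..<Suc (Suc m). fact ((x # a) ! i)) = (\<Prod>i=0..<Suc m. fact (a ! i) :: 'k)"
    using prod.shift_bounds_Suc_ivl[of "\<lambda>i. fact ((x # a) ! i) :: 'k" 0 "Suc m"] by simp
  also have "\<dots> = fact (a ! 0) * (\<Prod>i=1..<Suc m. fact (a ! i))"
    by (simp add: prod.atLeast_Suc_lessThan del: prod.op_ivl_Suc)
  finally show ?thesis .
qed

text \<open>
  If the exponent of \<open>v\<close> is zero, its factor in the denominator is \<open>\<alpha>!\<close>, and the shift is gone:
  the exponent of the next vector, which becomes the first one, occurs unshifted.
\<close>

lemma sum_compositions_zero_head:
  assumes "vs \<noteq> []"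
  shows "(\<Sum>a\<in>(#) 0 ` {a. length a = length vs \<and> sum_list a = k}.
            E (concat (map2 replicate a (v # vs))) fs /
              (fact (a ! 0 + \<alpha>) * (\<Prod>i=1..<length (v # vs). fact (a ! i))))
         = S k 0 vs fs / fact \<alpha>"
proof -
  obtain m where m: "length vs = Suc m"
    using assms by (cases vs) auto
  have "E (concat (map2 replicate (0 # a) (v # vs))) fs /
          (fact ((0 # a) ! 0 + \<alpha>) * (\<Prod>i=1..<length (v # vs). fact ((0 # a) ! i)))
      = E (concat (map2 replicate a vs)) fs /
          (fact (a ! 0 + 0) * (\<Prod>i=1..<length vs. fact (a ! i))) / fact \<alpha>"
    if "length a = length vs" for a
  proof -
    have "length a = Suc m"
      using that m by simp
    from S_coefficient_Cons[OF this, of 0] show ?thesis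
      unfolding length_Cons m by (simp only: nth_Cons_0 zip_Cons_Cons list.map concat.simps
          prod.case replicate_0 append_Nil add_0 add_0_right divide_divide_eq_left mult_ac)
  qed
  then show ?thesis
    unfolding S_tensor_def sum_divide_distrib
    by (subst sum.reindex) (auto intro!: sum.cong simp del: prod.op_ivl_Suc length_Cons)
qed

text \<open>
  Incrementing the exponent of the first vector is a bijection from the terms of order \<open>k\<close>
  onto the terms of order \<open>k + 1\<close> in which this exponent is positive; with the shift increased
  by one on the other side, the coefficients agree.
\<close>

lemma sum_compositions_positive_head:
  "(\<Sum>a\<in>(\<lambda>a. Suc (hd a) # tl a) ` {a. length a = Suc (length vs) \<and> sum_list a = k}.
       E (concat (map2 replicate a (v # vs))) fs /
         (fact (a ! 0 + \<alpha>) * (\<Prod>i=1..<length (v # vs). fact (a ! i))))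
   = tensor_Cons v (S k (Suc \<alpha>) (v # vs)) fs"
proof -
  have inj: "inj_on (\<lambda>a. Suc (hd a) # tl a) {a. length a = Suc (length vs) \<and> sum_list a = k}"
  proof (rule inj_onI)
    fix a b :: "nat list"
    assume "a \<in> {a. length a = Suc (length vs) \<and> sum_list a = k}"
      "b \<in> {a. length a = Suc (length vs) \<and> sum_list a = k}"
      "Suc (hd a) # tl a = Suc (hd b) # tl b"
    then show "a = b"
      by (cases a; cases b) auto
  qed
  have coeff: "(\<Prod>i=1..<Suc (length vs). fact ((x # a) ! i) :: 'k)
      = (\<Prod>i=1..<Suc (length vs). fact ((y # a) ! i))" for x y :: nat and a
    by (intro prod.cong) (auto simp: nth_Cons')
  have "E (concat (map2 replicate (Suc (hd a) # tl a) (v # vs))) fs /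
          (fact ((Suc (hd a) # tl a) ! 0 + \<alpha>) *
            (\<Prod>i=1..<Suc (length vs). fact ((Suc (hd a) # tl a) ! i)))
      = tensor_Cons v (\<lambda>gs. E (concat (map2 replicate a (v # vs))) gs /
          (fact (a ! 0 + Suc \<alpha>) * (\<Prod>i=1..<Suc (length vs). fact (a ! i)))) fs"
    if len: "length a = Suc (length vs)" for a
  proof -
    obtain x b where a: "a = x # b"
      using len by (cases a) auto
    show ?thesis
      unfolding a by (simp add: tensor_Cons_divide elementary_tensor_Cons coeff[of "Suc x" b x]
          del: prod.op_ivl_Suc)
  qed
  then show ?thesis
    unfolding S_tensor_def tensor_Cons_sum
    by (subst sum.reindex[OF inj]) (auto intro!: sum.cong simp del: prod.op_ivl_Suc)
qed

lemma S_0_Cons: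
  assumes "vs \<noteq> []"
  shows "S 0 \<alpha> (v # vs) fs = S 0 0 vs fs / fact \<alpha>"
proof -
  have zero: "{a::nat list. length a = length (v # vs) \<and> sum_list a = 0}
      = (#) 0 ` {a. length a = length vs \<and> sum_list a = 0}"
    by (auto simp: length_Suc_conv image_iff)
  show ?thesis
    unfolding sum_compositions_zero_head[OF assms, symmetric, where v = v and \<alpha> = \<alpha>]
      S_tensor_def[of scale 0 \<alpha> "v # vs"] zero ..
qed

lemma S_Suc:
  assumes "vs \<noteq> []"
  shows "S (Suc k) \<alpha> (v # vs) fs
           = tensor_Cons v (S k (Suc \<alpha>) (v # vs)) fs + S (Suc k) 0 vs fs / fact \<alpha>"
proof -
  let ?A = "(\<lambda>a. Suc (hd a) # tl a) ` {a. length a = Suc (length vs) \<and> sum_list a = k}"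
  let ?B = "(#) 0 ` {a. length a = length vs \<and> sum_list a = Suc k}"
  have split: "{a. length a = length (v # vs) \<and> sum_list a = Suc k} = ?A \<union> ?B"
  proof (intro equalityI subsetI)
    fix a assume a: "a \<in> {a. length a = length (v # vs) \<and> sum_list a = Suc k}"
    then obtain x b where xb: "a = x # b"
      by (cases a) auto
    show "a \<in> ?A \<union> ?B"
    proof (cases x)
      case 0
      then show ?thesis using a xb by auto
    next
      case (Suc y)
      then have "a = (\<lambda>a. Suc (hd a) # tl a) (y # b)"
        using xb by simp
      moreover have "y # b \<in> {a. length a = Suc (length vs) \<and> sum_list a = k}"
        using a xb Suc by simp
      ultimately show ?thesis by blast
    qed
  qed (auto simp: length_Suc_conv)
  have fin: "finite ?A" "finite ?B"
    by (intro finite_imageI finite_compositions)+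
  have disj: "?A \<inter> ?B = {}"
    by auto
  show ?thesis
    unfolding sum_compositions_positive_head[symmetric]
      sum_compositions_zero_head[OF assms, symmetric, where k = "Suc k" and v = v and \<alpha> = \<alpha>]
    unfolding S_tensor_def[of scale "Suc k" \<alpha> "v # vs"] split
    by (rule sum.union_disjoint[OF fin disj])
qed

lemma S_0: "vs \<noteq> [] \<Longrightarrow> S 0 \<alpha> vs fs = E [] fs / fact \<alpha>"
proof (induction vs arbitrary: \<alpha>)
  case (Cons v vs)
  then show ?case
    by (cases "vs = []") (simp_all add: S_single S_0_Cons)
qed simp

lemma S_1_elementary:
  assumes "vs \<noteq> []"
  obtains y where "S (Suc 0) \<alpha> vs = E [y]"
proof -
  have "\<exists>y. S (Suc 0) \<alpha> vs = E [y]"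
    using assms
  proof (induction vs arbitrary: \<alpha>)
    case (Cons v vs)
    show ?case
    proof (cases "vs = []")
      case True
      then have "S (Suc 0) \<alpha> (v # vs) = E [inverse (fact (Suc \<alpha>)) *s v]"
        by (auto simp: S_single elementary_tensor_Cons tensor_Cons_scale_vector field_simps)
      then show ?thesis by blast
    next
      case False
      obtain y where y: "S (Suc 0) 0 vs = E [y]"
        using Cons.IH[OF False] by blast
      have "S 0 (Suc \<alpha>) (v # vs) = (\<lambda>gs. E [] gs / fact (Suc \<alpha>))"
        by (rule ext, rule S_0) simp
      then have "S (Suc 0) \<alpha> (v # vs)
          = E [inverse (fact (Suc \<alpha>)) *s v + inverse (fact \<alpha>) *s y]"
        by (auto simp: S_Suc[OF False] y elementary_tensor_Cons tensor_Cons_scale_vector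
            tensor_Cons_add_vector tensor_Cons_divide field_simps)
      then show ?thesis by blast
    qed
  qed simp
  then show ?thesis using that by blast
qed

section \<open>Three vectors\<close>

lemma S_two_vectors:
  "S k \<alpha> [v, w] fs
     = (\<Sum>b\<le>k. E (replicate b v @ replicate (k - b) w) fs / (fact (b + \<alpha>) * fact (k - b)))"
proof (induction k arbitrary: \<alpha> fs)
  case 0
  show ?case by (simp add: S_0)
next
  case (Suc k)
  have IH: "S k (Suc \<alpha>) [v, w] = (\<lambda>gs. \<Sum>b\<le>k. E (replicate b v @ replicate (k - b) w) gs /
      (fact (b + Suc \<alpha>) * fact (k - b)))"
    using Suc.IH by blast
  have "S (Suc k) \<alpha> [v, w] fs
      = tensor_Cons v (S k (Suc \<alpha>) [v, w]) fs + S (Suc k) 0 [w] fs / fact \<alpha>"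
    by (rule S_Suc) simp
  also have "tensor_Cons v (S k (Suc \<alpha>) [v, w]) fs
      = (\<Sum>b\<le>k. E (replicate (Suc b) v @ replicate (Suc k - Suc b) w) fs /
          (fact (Suc b + \<alpha>) * fact (Suc k - Suc b)))"
    by (simp only: IH tensor_Cons_sum tensor_Cons_divide elementary_tensor_Cons replicate_Suc
        append_Cons diff_Suc_Suc add_Suc add_Suc_right)
  also have "S (Suc k) 0 [w] fs / fact \<alpha> = E (replicate 0 v @ replicate (Suc k - 0) w) fs /
      (fact (0 + \<alpha>) * fact (Suc k - 0))"
    by (simp only: S_single replicate_0 append_Nil diff_zero add_0 add_0_right
        divide_divide_eq_left mult.commute)
  finally show ?case
    by (simp only: sum.atMost_Suc_shift add.commute)
qed

text \<open>
  In \<open>u \<otimes> S\<^sub>k(v, w)\<close> and \<open>S\<^sub>k\<^sub>+\<^sub>1(v, w)\<close> the terms ending in \<open>v\<^sup>b \<otimes> w\<^sup>k\<^sup>-\<^sup>b\<close> differ only in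
  their first factor, so they can be collected into one elementary tensor for every \<open>b \<le> k\<close>.
  The one remaining term \<open>w\<^sup>k\<^sup>+\<^sup>1\<close> joins the group \<open>b = 0\<close>.
\<close>

lemma rank_two_vectors_pair:
  "rank_at_most (Suc k) (Suc k)
     (\<lambda>fs. c * tensor_Cons u (S k 0 [v, w]) fs + d * S (Suc k) 0 [v, w] fs)"
proof -
  let ?t = "\<lambda>b. replicate b v @ replicate (k - b) w"
  let ?p = "\<lambda>b. c / (fact b * fact (k - b))"
  let ?q = "\<lambda>b. d / (fact (Suc b) * fact (k - b))"
  let ?r = "d / fact (Suc k)"
  let ?x = "\<lambda>b. ?p b *s u + ?q b *s v + (if b = 0 then ?r *s w else 0)"
  have fst_part: "c * tensor_Cons u (S k 0 [v, w]) fs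
      = (\<Sum>b\<le>k. ?p b * tensor_Cons u (E (?t b)) fs)" for fs
  proof -
    have "S k 0 [v, w] = (\<lambda>gs. \<Sum>b\<le>k. E (?t b) gs / (fact b * fact (k - b)))"
      by (auto simp: S_two_vectors)
    then show ?thesis
      by (simp only: tensor_Cons_sum tensor_Cons_divide sum_distrib_left times_divide_eq_left
          times_divide_eq_right)
  qed
  have snd_part: "d * S (Suc k) 0 [v, w] fs
      = (\<Sum>b\<le>k. ?q b * tensor_Cons v (E (?t b)) fs) + ?r * tensor_Cons w (E (?t 0)) fs" for fs
    by (simp only: S_two_vectors sum.atMost_Suc_shift replicate_Suc replicate_0 append_Cons
        append_Nil diff_Suc_Suc diff_zero add_0_right fact_0 mult_1 elementary_tensor_Cons
        sum_distrib_left distrib_left times_divide_eq_left times_divide_eq_right add.commute)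
  have zero: "tensor_Cons 0 T fs = 0" for T fs
    using tensor_Cons_scale_vector[of 0 0 T fs] by simp
  have rest: "(\<Sum>b\<le>k. tensor_Cons (if b = 0 then ?r *s w else 0) (E (?t b)) fs)
      = ?r * tensor_Cons w (E (?t 0)) fs" for fs
  proof -
    have "(\<Sum>b\<le>k. tensor_Cons (if b = 0 then ?r *s w else 0) (E (?t b)) fs)
        = (\<Sum>b\<le>k. if b = 0 then ?r * tensor_Cons w (E (?t 0)) fs else 0)"
      by (intro sum.cong refl) (simp add: zero tensor_Cons_scale_vector del: fact_Suc)
    then show ?thesis
      by (simp only: sum.delta finite_atMost atMost_iff le0 if_True)
  qed
  have eq: "c * tensor_Cons u (S k 0 [v, w]) fs + d * S (Suc k) 0 [v, w] fs
      = (\<Sum>b<Suc k. E (?x b # ?t b) fs)" for fs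
    unfolding fst_part snd_part rest[symmetric] lessThan_Suc_atMost
    by (simp only: elementary_tensor_Cons tensor_Cons_add_vector tensor_Cons_scale_vector
        sum.distrib add.assoc)
  show ?thesis
    unfolding eq by (rule rank_at_most_sum) auto
qed

text \<open>
  Peeling \<open>u\<close> off twice leaves \<open>u \<otimes> u \<otimes> S\<^sub>k\<^sub>,\<^sub>\<alpha>\<^sub>+\<^sub>2\<close> and a combination of \<open>u \<otimes> S\<^sub>k\<^sub>+\<^sub>1(v, w)\<close> and
  \<open>S\<^sub>k\<^sub>+\<^sub>2(v, w)\<close>.
\<close>

lemma rank_S_three_vectors_step:
  assumes "rank_at_most (Suc k) r (tensor_Cons u (S k (Suc (Suc \<alpha>)) [u, v, w]))"
  shows "rank_at_most (Suc (Suc k)) (r + Suc (Suc k)) (S (Suc (Suc k)) \<alpha> [u, v, w])"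
proof -
  let ?T = "tensor_Cons u (S k (Suc (Suc \<alpha>)) [u, v, w])"
  have S1: "S (Suc k) (Suc \<alpha>) [u, v, w] = (\<lambda>gs. ?T gs + S (Suc k) 0 [v, w] gs / fact (Suc \<alpha>))"
    by (rule ext, rule S_Suc) simp
  have "S (Suc (Suc k)) \<alpha> [u, v, w] fs
      = tensor_Cons u (S (Suc k) (Suc \<alpha>) [u, v, w]) fs
        + S (Suc (Suc k)) 0 [v, w] fs / fact \<alpha>" for fs
    by (rule S_Suc) simp
  then have eq: "S (Suc (Suc k)) \<alpha> [u, v, w] = (\<lambda>fs. tensor_Cons u ?T fs
      + (inverse (fact (Suc \<alpha>)) * tensor_Cons u (S (Suc k) 0 [v, w]) fs
        + inverse (fact \<alpha>) * S (Suc (Suc k)) 0 [v, w] fs))"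
    unfolding S1 by (intro ext)
      (simp only: tensor_Cons_add tensor_Cons_divide, simp only: divide_inverse mult.commute
        add.assoc)
  show ?thesis
    unfolding eq
    by (rule rank_at_most_add[OF rank_at_most_tensor_Cons[OF assms] rank_two_vectors_pair])
qed

text \<open>
  The numerical bound is \<open>\<lceil>(k+2)\<^sup>2/4\<rceil>\<close>, written without rationals. It grows by \<open>k + 1\<close> between
  the orders \<open>k - 1\<close> and \<open>k + 1\<close>, which is the cost of the terms with exponent at most one at \<open>u\<close>.
\<close>

lemma rank_S_three_vectors: "rank_at_most (Suc k) (((k + 2)\<^sup>2 + 3) div 4) (S (Suc k) \<alpha> [u, v, w])"
proof (induction k arbitrary: \<alpha> rule: induct_nat_012)
  case 0
  obtain y where "S (Suc 0) \<alpha> [u, v, w] = E [y]"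
    by (rule S_1_elementary[of "[u, v, w]" \<alpha>]) simp
  then show ?case
    using rank_at_most_elementary[of "[y]" "Suc 0"] by (simp add: power2_eq_square)
next
  case 1
  \<comment> \<open>\<open>S\<^sub>0\<close> is a scalar that need not be \<open>1\<close>, hence no elementary tensor; but \<open>u \<otimes> S\<^sub>0\<close> is one.\<close>
  have "S 0 (Suc (Suc \<alpha>)) [u, v, w] = (\<lambda>gs. E [] gs / fact (Suc (Suc \<alpha>)))"
    by (rule ext, rule S_0) simp
  then have "tensor_Cons u (S 0 (Suc (Suc \<alpha>)) [u, v, w]) = E [inverse (fact (Suc (Suc \<alpha>))) *s u]"
    by (intro ext) (simp only: elementary_tensor_Cons tensor_Cons_scale_vector tensor_Cons_divide,
        simp only: divide_inverse mult.commute)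
  then have "rank_at_most (Suc 0) 1 (tensor_Cons u (S 0 (Suc (Suc \<alpha>)) [u, v, w]))"
    by (simp only:) (rule rank_at_most_elementary, simp)
  from rank_S_three_vectors_step[OF this]
  have "rank_at_most (Suc (Suc 0)) 3 (S (Suc (Suc 0)) \<alpha> [u, v, w])"
    by (simp add: numeral_3_eq_3)
  then show ?case
    by (simp add: power2_eq_square)
next
  case (ge2 k)
  have "rank_at_most (Suc (Suc (Suc k))) (((k + 2)\<^sup>2 + 3) div 4 + Suc (Suc (Suc k)))
      (S (Suc (Suc (Suc k))) \<alpha> [u, v, w])"
    by (intro rank_S_three_vectors_step rank_at_most_tensor_Cons ge2.IH)
  moreover have "((Suc (Suc k) + 2)\<^sup>2 + 3) div 4 = ((k + 2)\<^sup>2 + 3) div 4 + Suc (Suc (Suc k))"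
  proof -
    have "(Suc (Suc k) + 2)\<^sup>2 + 3 = ((k + 2)\<^sup>2 + 3) + Suc (Suc (Suc k)) * 4"
      by (simp add: power2_eq_square algebra_simps)
    moreover have "(n + c * 4) div 4 = n div 4 + c" for n c :: nat
      by simp
    ultimately show ?thesis by (simp only:)
  qed
  ultimately show ?case by simp
qed

section \<open>Order three\<close>

text \<open>
  The summand \<open>x \<otimes> S\<^sub>2\<close> makes the induction close: peeling \<open>w\<close> off both summands leaves
  \<open>w \<otimes> S\<^sub>2\<close> of the remaining vectors, which is absorbed by replacing \<open>x\<close> by \<open>x + c w\<close>, and the
  two elementary tensors \<open>x \<otimes> w \<otimes> S\<^sub>1\<^sub>,\<^sub>1\<close> and \<open>c w \<otimes> w \<otimes> S\<^sub>1\<^sub>,\<^sub>2\<close>.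
\<close>

lemma rank_order_two_and_three:
  assumes "vs \<noteq> []"
  shows "rank_at_most 3 (2 * length vs - 1) (\<lambda>fs. tensor_Cons x (S 2 0 vs) fs + c * S 3 0 vs fs)"
  using assms
proof (induction vs arbitrary: x)
  case (Cons w vs)
  show ?case
  proof (cases "vs = []")
    case True
    have "(\<lambda>fs. tensor_Cons x (S 2 0 (w # vs)) fs + c * S 3 0 (w # vs) fs)
        = E [inverse 2 *s x + (c / 6) *s w, w, w]"
      by (rule ext) (simp add: True S_single numeral_eq_Suc tensor_Cons_divide
          elementary_tensor_Cons tensor_Cons_add_vector tensor_Cons_scale_vector field_simps)
    then show ?thesis
      using rank_at_most_elementary[of "[inverse 2 *s x + (c / 6) *s w, w, w]" 3] True by simp
  next
    case False
    obtain y where y: "S (Suc 0) (Suc 0) (w # vs) = E [y]"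
      by (rule S_1_elementary[of "w # vs" "Suc 0"]) simp
    obtain z where z: "S (Suc 0) (Suc (Suc 0)) (w # vs) = E [z]"
      by (rule S_1_elementary[of "w # vs" "Suc (Suc 0)"]) simp
    have two: "S 2 \<beta> (w # vs)
        = (\<lambda>gs. tensor_Cons w (S (Suc 0) (Suc \<beta>) (w # vs)) gs + S 2 0 vs gs / fact \<beta>)" for \<beta>
      using S_Suc[OF False, of "Suc 0" \<beta> w] by (auto simp: numeral_2_eq_2)
    have three: "S 3 0 (w # vs) fs
        = tensor_Cons w (S 2 (Suc 0) (w # vs)) fs + S 3 0 vs fs" for fs
      using S_Suc[OF False, of 2 0 w fs] by (simp add: numeral_3_eq_3 numeral_2_eq_2)
    have "tensor_Cons x (S 2 0 (w # vs)) fs + c * S 3 0 (w # vs) fs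
        = (E [x, w, y] fs + c * E [w, w, z] fs)
          + (tensor_Cons (x + c *s w) (S 2 0 vs) fs + c * S 3 0 vs fs)" for fs
      by (simp add: three two y z tensor_Cons_add elementary_tensor_Cons
          tensor_Cons_add_vector tensor_Cons_scale_vector tensor_Cons_divide algebra_simps)
    moreover have "rank_at_most 3 ((1 + 1) + (2 * length vs - 1))
        (\<lambda>fs. (E [x, w, y] fs + c * E [w, w, z] fs)
          + (tensor_Cons (x + c *s w) (S 2 0 vs) fs + c * S 3 0 vs fs))"
      using rank_at_most_mult[of 2 1 "E [w, w, z]" c] rank_at_most_elementary[of "[w, w, z]" 3]
      by (intro rank_at_most_add Cons.IH[OF False] rank_at_most_elementary)
        (simp_all add: numeral_3_eq_3 numeral_2_eq_2)
    moreover have "(1 + 1) + (2 * length vs - 1) = 2 * length (w # vs) - 1"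
      using False by (cases vs) auto
    ultimately show ?thesis by simp
  qed
qed simp

lemma rank_S_order_three:
  assumes "vs \<noteq> []"
  shows "rank_at_most 3 (2 * length vs) (S 3 \<alpha> (v # vs))"
proof -
  obtain y where y: "S (Suc 0) (Suc (Suc \<alpha>)) (v # vs) = E [y]"
    by (rule S_1_elementary[of "v # vs" "Suc (Suc \<alpha>)"]) simp
  have two: "S 2 (Suc \<alpha>) (v # vs)
      = (\<lambda>gs. tensor_Cons v (E [y]) gs + S 2 0 vs gs / fact (Suc \<alpha>))"
    using S_Suc[OF assms, of "Suc 0" "Suc \<alpha>" v] by (auto simp: numeral_2_eq_2 y)
  have "S 3 \<alpha> (v # vs) fs = tensor_Cons v (S 2 (Suc \<alpha>) (v # vs)) fs + S 3 0 vs fs / fact \<alpha>" for fs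
    using S_Suc[OF assms, of 2 \<alpha> v fs] by (simp add: numeral_3_eq_3 numeral_2_eq_2)
  then have "S 3 \<alpha> (v # vs) = (\<lambda>fs. E [v, v, y] fs
      + (tensor_Cons (inverse (fact (Suc \<alpha>)) *s v) (S 2 0 vs) fs
        + inverse (fact \<alpha>) * S 3 0 vs fs))"
    by (intro ext) (simp only: two tensor_Cons_add elementary_tensor_Cons
        tensor_Cons_scale_vector tensor_Cons_divide, simp only: divide_inverse mult.commute
        add.assoc)
  moreover have "rank_at_most 3 (1 + (2 * length vs - 1)) \<dots>"
    by (intro rank_at_most_add rank_order_two_and_three assms rank_at_most_elementary) simp
  moreover have "1 + (2 * length vs - 1) = 2 * length vs"
    using assms by (cases vs) auto
  ultimately show ?thesis by simp
qed

end

section \<open>The Pascal recurrence of the bound\<close>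

text \<open>
  The bound of the theorem for \<open>k = K + 3\<close> and \<open>m = M + 4\<close>. The shift puts both boundary cases
  at \<open>0\<close> and avoids truncated subtraction in the binomial coefficients. As in the case of three
  vectors, \<open>(n\<^sup>2 + 3) div 4\<close> stands for \<open>\<lceil>n\<^sup>2/4\<rceil>\<close>.
\<close>

definition rank_bound :: "nat \<Rightarrow> nat \<Rightarrow> nat" where
  "rank_bound K M = (\<Sum>j<K. ((M + j) choose j) * (((K + 4 - j)\<^sup>2 + 3) div 4))
     + 2 * (Suc (M + K) choose Suc K) + 4 * ((M + K) choose K)"

lemma rank_bound_order_three: "rank_bound 0 M = 2 * (M + 3)"
  by (simp add: rank_bound_def)

text \<open>
  The summand \<open>\<lceil>(K+5)\<^sup>2/4\<rceil>\<close> is the bound for three vectors in order \<open>K + 4\<close>, so this is the Pascal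
  recurrence at the boundary \<open>m = 3\<close>.
\<close>

lemma rank_bound_four_vectors: "rank_bound (Suc K) 0 = rank_bound K 0 + ((K + 5)\<^sup>2 + 3) div 4"
  unfolding rank_bound_def by (subst sum.lessThan_Suc_shift) (simp add: add.commute)

lemma rank_bound_Suc: "rank_bound (Suc K) (Suc M) = rank_bound K (Suc M) + rank_bound (Suc K) M"
proof -
  let ?q = "\<lambda>n. (n\<^sup>2 + 3) div 4 :: nat"
  have "(\<Sum>j<Suc K. ((Suc M + j) choose j) * ?q (Suc K + 4 - j))
      = ?q (K + 5) + (\<Sum>j<K. (Suc (Suc M + j) choose Suc j) * ?q (K + 4 - j))"
    by (subst sum.lessThan_Suc_shift) (simp add: add.commute)
  also have "\<dots> = (?q (K + 5) + (\<Sum>j<K. ((M + Suc j) choose Suc j) * ?q (K + 4 - j)))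
      + (\<Sum>j<K. ((Suc M + j) choose j) * ?q (K + 4 - j))"
    by (simp add: distrib_right sum.distrib)
  also have "?q (K + 5) + (\<Sum>j<K. ((M + Suc j) choose Suc j) * ?q (K + 4 - j))
      = (\<Sum>j<Suc K. ((M + j) choose j) * ?q (Suc K + 4 - j))"
    by (subst sum.lessThan_Suc_shift) (simp add: add.commute)
  finally show ?thesis
    unfolding rank_bound_def by simp
qed

lemma ceiling_divide_4: "\<lceil>real n / 4\<rceil> = int ((n + 3) div 4)"
proof (rule ceiling_unique)
  have "n \<le> 4 * ((n + 3) div 4)" "4 * ((n + 3) div 4) \<le> n + 3"
    by linarith+
  then show "real_of_int (int ((n + 3) div 4)) - 1 < real n / 4"
    "real n / 4 \<le> real_of_int (int ((n + 3) div 4))"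
    by linarith+
qed

lemma rank_bound_eq:
  assumes "k \<ge> 3" "m \<ge> 4"
  shows "int (rank_bound (k - 3) (m - 4))
    = (\<Sum>j<k - 3. int ((m + j - 4) choose j) * \<lceil>real ((k - j + 1)\<^sup>2) / 4\<rceil>)
      + 2 * int ((m + k - 6) choose (k - 2)) + 4 * int ((m + k - 7) choose (k - 3))"
proof -
  obtain K M where k: "k = K + 3" and m: "m = M + 4"
    using assms by (metis add.commute le_Suc_ex)
  have "(\<Sum>j<K. int ((M + j) choose j) * int (((K + 4 - j)\<^sup>2 + 3) div 4))
      = (\<Sum>j<k - 3. int ((m + j - 4) choose j) * \<lceil>real ((k - j + 1)\<^sup>2) / 4\<rceil>)"
  proof (rule sum.cong)
    fix j assume "j \<in> {..<k - 3}"
    then have "k - j + 1 = K + 4 - j" "m + j - 4 = M + j"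
      using k m by auto
    then show "int ((M + j) choose j) * int (((K + 4 - j)\<^sup>2 + 3) div 4)
        = int ((m + j - 4) choose j) * \<lceil>real ((k - j + 1)\<^sup>2) / 4\<rceil>"
      by (simp only: ceiling_divide_4)
  qed (simp add: k)
  moreover have "m + k - 6 = Suc (M + K)" "k - 2 = Suc K" "m + k - 7 = M + K"
    using k m by auto
  ultimately show ?thesis
    using k m by (simp add: rank_bound_def)
qed

section \<open>The bound on the rank\<close>

context char_0_vector_space
begin

lemma rank_S_at_most:
  assumes "length vs = M + 4"
  shows "rank_at_most (K + 3) (rank_bound K M) (S (K + 3) \<alpha> vs)"
  using assms
proof (induction "K + M" arbitrary: K M \<alpha> vs rule: less_induct)
  case less
  obtain v us where vs: "vs = v # us"
    using less.prems by (cases vs) auto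
  have us: "us \<noteq> []" "length us = M + 3"
    using vs less.prems by auto
  show ?case
  proof (cases K)
    case 0
    then show ?thesis
      using rank_S_order_three[OF us(1)] us(2) by (simp add: vs rank_bound_order_three)
  next
    case (Suc L)
    have eq: "S (K + 3) \<alpha> vs = (\<lambda>fs. tensor_Cons v (S (L + 3) (Suc \<alpha>) vs) fs
        + S (Suc (L + 3)) 0 us fs / fact \<alpha>)"
      using S_Suc[OF us(1), of "L + 3" \<alpha> v] by (auto simp: Suc vs)
    have "rank_at_most (L + 3) (rank_bound L M) (S (L + 3) (Suc \<alpha>) vs)"
      using less.hyps[of L M] less.prems Suc by simp
    \<comment> \<open>The second summand has one vector less: three vectors if \<open>M = 0\<close>.\<close>
    moreover have "\<exists>r. rank_bound K M = rank_bound L M + r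
        \<and> rank_at_most (Suc (L + 3)) r (S (Suc (L + 3)) 0 us)"
    proof (cases M)
      case 0
      then obtain x y z where "us = [x, y, z]"
        using us(2) by (auto simp: numeral_eq_Suc length_Suc_conv)
      then show ?thesis
        using rank_S_three_vectors[of "L + 3" 0 x y z] 0
        by (auto simp: Suc rank_bound_four_vectors add.commute)
    next
      case (Suc N)
      then have "rank_at_most (K + 3) (rank_bound K N) (S (K + 3) 0 us)"
        using less.hyps[of K N] us(2) by simp
      then show ?thesis
        using Suc \<open>K = Suc L\<close> by (auto simp: rank_bound_Suc)
    qed
    ultimately obtain r where r: "rank_bound K M = rank_bound L M + r"
      and "rank_at_most (Suc (L + 3)) (rank_bound L M) (tensor_Cons v (S (L + 3) (Suc \<alpha>) vs))"
      and "rank_at_most (Suc (L + 3)) r (S (Suc (L + 3)) 0 us)"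
      using rank_at_most_tensor_Cons by blast
    then have "rank_at_most (Suc (L + 3)) (rank_bound L M + r) (S (K + 3) \<alpha> vs)"
      unfolding eq by (intro rank_at_most_add rank_at_most_divide)
    then show ?thesis
      unfolding r using Suc by simp
  qed
qed

lemma tensor_rank_S_le:
  assumes "k \<ge> 3" "m \<ge> 4" "length vs = m"
  shows "int (tensor_rank scale k (S k \<alpha> vs))
    \<le> (\<Sum>j<k - 3. int ((m + j - 4) choose j) * \<lceil>real ((k - j + 1)\<^sup>2) / 4\<rceil>)
      + 2 * int ((m + k - 6) choose (k - 2)) + 4 * int ((m + k - 7) choose (k - 3))"
proof -
  have "rank_at_most k (rank_bound (k - 3) (m - 4)) (S k \<alpha> vs)"
    using rank_S_at_most[of vs "m - 4" "k - 3" \<alpha>] assms by simp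
  then show ?thesis
    using tensor_rank_le rank_bound_eq[OF assms(1,2)] by (metis of_nat_le_iff)
qed

end

theorem theorem3p15:
  fixes k m \<alpha> :: nat
  assumes "k \<ge> 3" and "m \<ge> 4"
  shows "(\<forall>(scale :: real \<Rightarrow> 'v::ab_group_add \<Rightarrow> 'v) Basis vs.
            finite_dimensional_vector_space scale Basis \<longrightarrow> length vs = m \<longrightarrow>
            int (tensor_rank scale k (S_tensor scale k \<alpha> vs))
              \<le> (\<Sum>j<k - 3. int ((m + j - 4) choose j) * \<lceil>real ((k - j + 1)\<^sup>2) / 4\<rceil>)
                + 2 * int ((m + k - 6) choose (k - 2)) + 4 * int ((m + k - 7) choose (k - 3)))
       \<and> (\<forall>(scale :: complex \<Rightarrow> 'w::ab_group_add \<Rightarrow> 'w) Basis vs.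
            finite_dimensional_vector_space scale Basis \<longrightarrow> length vs = m \<longrightarrow>
            int (tensor_rank scale k (S_tensor scale k \<alpha> vs))
              \<le> (\<Sum>j<k - 3. int ((m + j - 4) choose j) * \<lceil>real ((k - j + 1)\<^sup>2) / 4\<rceil>)
                + 2 * int ((m + k - 6) choose (k - 2)) + 4 * int ((m + k - 7) choose (k - 3)))"
proof (intro conjI allI impI)
  fix scale :: "real \<Rightarrow> 'v \<Rightarrow> 'v" and Basis and vs :: "'v list"
  assume "finite_dimensional_vector_space scale Basis" and len: "length vs = m"
  then interpret char_0_vector_space scale
    by (simp add: finite_dimensional_vector_space_def char_0_vector_space_def)
  show "int (tensor_rank scale k (S_tensor scale k \<alpha> vs))
      \<le> (\<Sum>j<k - 3. int ((m + j - 4) choose j) * \<lceil>real ((k - j + 1)\<^sup>2) / 4\<rceil>)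
        + 2 * int ((m + k - 6) choose (k - 2)) + 4 * int ((m + k - 7) choose (k - 3))"
    by (rule tensor_rank_S_le[OF assms len])
next
  fix scale :: "complex \<Rightarrow> 'w \<Rightarrow> 'w" and Basis and vs :: "'w list"
  assume "finite_dimensional_vector_space scale Basis" and len: "length vs = m"
  then interpret char_0_vector_space scale
    by (simp add: finite_dimensional_vector_space_def char_0_vector_space_def)
  show "int (tensor_rank scale k (S_tensor scale k \<alpha> vs))
      \<le> (\<Sum>j<k - 3. int ((m + j - 4) choose j) * \<lceil>real ((k - j + 1)\<^sup>2) / 4\<rceil>)
        + 2 * int ((m + k - 6) choose (k - 2)) + 4 * int ((m + k - 7) choose (k - 3))"
    by (rule tensor_rank_S_le[OF assms len])
qed

end
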